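(* Let $t\ge 2$ be an integer and $\mu_t=\binom{2t-1}{t}^{1/(2t-1)}$. There are positive constants $d_t$, $D_t$, $D'_t$ such that for every $n\ge 2t-1$ there is a $t$-CNF theory $T$ (respectively, a normal $t$-program $P$, a disjunctive $t$-program $Q$) with $n$ atoms such that (1) its size $m$ satisfies $m\le d_t n$, and (2) the number of its minimal models (respectively, stable models of $P$, answer sets of $Q$) is at least $D_t\mu_t^n$ and the sum of their cardinalities is at least $D'_t\, n\,\mu_t^n$.
   Context: A $t$-CNF theory is a finite set of propositional clauses each with at most $t$ literals (no repeated literal, no complementary pair). A normal program clause has the form $a \leftarrow b_1,\ldots,b_r,\mathbf{not}(c_1),\ldots,\mathbf{not}(c_s)$ and a disjunctive one the form $a_1\vee\cdots\vee a_p \leftarrow b_1,\ldots,b_r,\mathbf{not}(c_1),\ldots,\mathbf{not}(c_s)$; a (normal or disjunctive) $t$-program is a finite set of such clauses with at most $t$ literals each. Models, stable models (Gelfond–Lifschitz) and answer sets (minimal models of the Gelfond–Lifschitz reduct $P^M$) are sets of true atoms; a model is minimal if no proper subset is a model. The size of a theory or program is the total number of atom occurrences. *)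

theory Defs
  imports Complex_Main
begin

datatype 'a literal = Pos (atom_of: 'a) | Neg (atom_of: 'a)

type_synonym 'a cnf_clause = "'a literal set"

text \<open>
  Clauses are sets of literals, so that no literal is repeated. Models are not confined to the
  atoms that occur, but minimal models, stable models and answer sets contain no other atoms.
\<close>

definition t_cnf :: "nat \<Rightarrow> 'a cnf_clause set \<Rightarrow> bool" where
  "t_cnf t T \<longleftrightarrow> finite T \<and>
     (\<forall>C\<in>T. finite C \<and> card C \<le> t \<and> \<not> (\<exists>a. Pos a \<in> C \<and> Neg a \<in> C))"

definition cnf_atoms :: "'a cnf_clause set \<Rightarrow> 'a set" where
  "cnf_atoms T = (\<Union>C\<in>T. atom_of ` C)"

definition cnf_size :: "'a cnf_clause set \<Rightarrow> nat" where
  "cnf_size T = (\<Sum>C\<in>T. card C)"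

fun lit_true :: "'a set \<Rightarrow> 'a literal \<Rightarrow> bool" where
  "lit_true M (Pos a) \<longleftrightarrow> a \<in> M"
| "lit_true M (Neg a) \<longleftrightarrow> a \<notin> M"

definition cnf_model :: "'a cnf_clause set \<Rightarrow> 'a set \<Rightarrow> bool" where
  "cnf_model T M \<longleftrightarrow> (\<forall>C\<in>T. \<exists>l\<in>C. lit_true M l)"

definition cnf_minimal_model :: "'a cnf_clause set \<Rightarrow> 'a set \<Rightarrow> bool" where
  "cnf_minimal_model T M \<longleftrightarrow> cnf_model T M \<and> (\<forall>N. N \<subset> M \<longrightarrow> \<not> cnf_model T N)"

text \<open>
  The value \<open>Rule {a\<^sub>1,\<dots>,a\<^sub>p} {b\<^sub>1,\<dots>,b\<^sub>r} {c\<^sub>1,\<dots>,c\<^sub>s}\<close> stands for the program clause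
  \<open>a\<^sub>1 \<or> \<dots> \<or> a\<^sub>p \<leftarrow> b\<^sub>1,\<dots>,b\<^sub>r, not(c\<^sub>1),\<dots>,not(c\<^sub>s)\<close>.
\<close>

datatype 'a rule = Rule (rule_head: "'a set") (pos_body: "'a set") (neg_body: "'a set")

type_synonym 'a program = "'a rule set"

text \<open>
  The number of literals of a clause, head included. An atom with several roles in the clause
  (head, positive body, negated body) is counted once for each, so this is also the number of
  atom occurrences.
\<close>

definition rule_size :: "'a rule \<Rightarrow> nat" where
  "rule_size r = card (rule_head r) + card (pos_body r) + card (neg_body r)"

definition disjunctive_t_program :: "nat \<Rightarrow> 'a program \<Rightarrow> bool" where
  "disjunctive_t_program t P \<longleftrightarrow> finite P \<and>
     (\<forall>r\<in>P. finite (rule_head r) \<and> finite (pos_body r) \<and> finite (neg_body r) \<and>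
            rule_head r \<noteq> {} \<and> rule_size r \<le> t)"

definition normal_t_program :: "nat \<Rightarrow> 'a program \<Rightarrow> bool" where
  "normal_t_program t P \<longleftrightarrow> finite P \<and>
     (\<forall>r\<in>P. (\<exists>a. rule_head r = {a}) \<and> finite (pos_body r) \<and> finite (neg_body r) \<and>
            rule_size r \<le> t)"

definition program_atoms :: "'a program \<Rightarrow> 'a set" where
  "program_atoms P = (\<Union>r\<in>P. rule_head r \<union> pos_body r \<union> neg_body r)"

definition program_size :: "'a program \<Rightarrow> nat" where
  "program_size P = (\<Sum>r\<in>P. rule_size r)"

definition program_model :: "'a program \<Rightarrow> 'a set \<Rightarrow> bool" where
  "program_model P M \<longleftrightarrow>
     (\<forall>r\<in>P. pos_body r \<subseteq> M \<and> neg_body r \<inter> M = {} \<longrightarrow> rule_head r \<inter> M \<noteq> {})"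

definition reduct :: "'a program \<Rightarrow> 'a set \<Rightarrow> 'a program" where
  "reduct P M = {Rule (rule_head r) (pos_body r) {} | r. r \<in> P \<and> neg_body r \<inter> M = {}}"

text \<open>
  The Gelfond--Lifschitz notion for normal programs: the reduct is then a definite Horn program,
  whose least model is required to be \<open>M\<close>.
\<close>

definition stable_model :: "'a program \<Rightarrow> 'a set \<Rightarrow> bool" where
  "stable_model P M \<longleftrightarrow>
     program_model (reduct P M) M \<and> (\<forall>N. program_model (reduct P M) N \<longrightarrow> M \<subseteq> N)"

definition program_minimal_model :: "'a program \<Rightarrow> 'a set \<Rightarrow> bool" where
  "program_minimal_model P M \<longleftrightarrow> program_model P M \<and> (\<forall>N. N \<subset> M \<longrightarrow> \<not> program_model P N)"

definition answer_set :: "'a program \<Rightarrow> 'a set \<Rightarrow> bool" where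
  "answer_set P M \<longleftrightarrow> program_minimal_model (reduct P M) M"

definition mu :: "nat \<Rightarrow> real" where
  "mu t = real ((2 * t - 1) choose t) powr (1 / real (2 * t - 1))"

end

theory Submission imports Defs "HOL-Library.FuncSet" begin

text \<open>
  Split \<open>k (2 t - 1)\<close> of the \<open>n\<close> atoms into \<open>k = n div (2 t - 1)\<close> blocks of size \<open>2 t - 1\<close>, and
  let \<open>E\<close> consist of all \<open>t\<close>-subsets of the blocks together with the singletons of the remaining
  atoms. A set that contains exactly \<open>t\<close> atoms of every block and all remaining atoms is a minimal
  transversal of \<open>E\<close>, and there are \<open>((2 t - 1) choose t) ^ k\<close> of these. The minimal transversals of
  \<open>E\<close> are minimal models of the positive clauses \<open>A \<in> E\<close>, answer sets of the disjunctions \<open>A \<in> E\<close>,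
  and stable models of the program with the clauses \<open>a \<leftarrow> not(A - {a})\<close> for \<open>a \<in> A \<in> E\<close>.
\<close>

text \<open>The last conjunct gives each atom of \<open>M\<close> a private edge. This is the local
  form of inclusion-minimality, and it is also what lets a normal program derive the atom.\<close>

definition minimal_transversal :: "'a set set \<Rightarrow> 'a set \<Rightarrow> bool" where
  "minimal_transversal E M \<longleftrightarrow>
     M \<subseteq> \<Union>E \<and> (\<forall>A\<in>E. A \<inter> M \<noteq> {}) \<and> (\<forall>a\<in>M. \<exists>A\<in>E. A \<inter> M = {a})"

text \<open>The private edge of an atom lost in passing from \<open>M\<close> to \<open>N\<close> is
  no longer hit.\<close>

lemma minimal_transversal_no_smaller:
  assumes "minimal_transversal E M" "N \<subset> M"
  shows "\<exists>A\<in>E. A \<inter> N = {}"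
proof -
  obtain a where a: "a \<in> M" "a \<notin> N" using assms(2) by blast
  then obtain A where "A \<in> E" "A \<inter> M = {a}"
    using assms(1) by (auto simp: minimal_transversal_def)
  moreover from this have "A \<inter> N = {}" using a(2) assms(2) by fast
  ultimately show ?thesis by blast
qed

section \<open>Clauses and programs over a hypergraph\<close>

definition edge_cnf :: "'a set set \<Rightarrow> 'a cnf_clause set" where
  "edge_cnf E = (\<lambda>A. Pos ` A) ` E"

definition edge_disjunctions :: "'a set set \<Rightarrow> 'a program" where
  "edge_disjunctions E = (\<lambda>A. Rule A {} {}) ` E"

text \<open>The disjunction over an edge is shifted: each of its atoms becomes the head of one rule,
  and the others move negated into the body. An edge thus yields up to \<open>card A\<close> rules,
  each with \<open>card A\<close> literals.\<close>

definition edge_normal_program :: "'a set set \<Rightarrow> 'a program" where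
  "edge_normal_program E = (\<lambda>(A, a). Rule {a} {} (A - {a})) ` (SIGMA A:E. A)"

lemma cnf_model_edge_cnf: "cnf_model (edge_cnf E) M \<longleftrightarrow> (\<forall>A\<in>E. A \<inter> M \<noteq> {})"
  by (auto simp: cnf_model_def edge_cnf_def)

lemma cnf_atoms_edge_cnf: "cnf_atoms (edge_cnf E) = \<Union>E"
  by (auto simp: cnf_atoms_def edge_cnf_def image_image)

lemma t_cnf_edge_cnf:
  assumes "finite E" "\<And>A. A \<in> E \<Longrightarrow> finite A \<and> card A \<le> t"
  shows "t_cnf t (edge_cnf E)"
  using assms by (auto simp: t_cnf_def edge_cnf_def card_image inj_on_def)

lemma cnf_minimal_model_edge_cnf:
  assumes "minimal_transversal E M"
  shows "cnf_minimal_model (edge_cnf E) M"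
  using assms minimal_transversal_no_smaller[OF assms]
  by (auto simp: cnf_minimal_model_def cnf_model_edge_cnf minimal_transversal_def)

lemma program_model_edge_disjunctions:
  "program_model (edge_disjunctions E) M \<longleftrightarrow> (\<forall>A\<in>E. A \<inter> M \<noteq> {})"
  by (auto simp: program_model_def edge_disjunctions_def)

lemma program_atoms_edge_disjunctions: "program_atoms (edge_disjunctions E) = \<Union>E"
  by (auto simp: program_atoms_def edge_disjunctions_def)

lemma reduct_edge_disjunctions: "reduct (edge_disjunctions E) M = edge_disjunctions E"
  unfolding reduct_def edge_disjunctions_def by force

lemma disjunctive_t_program_edge_disjunctions:
  assumes "finite E" "\<And>A. A \<in> E \<Longrightarrow> finite A \<and> A \<noteq> {} \<and> card A \<le> t"
  shows "disjunctive_t_program t (edge_disjunctions E)"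
  using assms by (auto simp: disjunctive_t_program_def edge_disjunctions_def rule_size_def)

text \<open>Without negated atoms the reduct is the program itself, so answer sets are just its
  minimal models.\<close>

lemma answer_set_edge_disjunctions:
  assumes "minimal_transversal E M"
  shows "answer_set (edge_disjunctions E) M"
  using assms minimal_transversal_no_smaller[OF assms]
  by (auto simp: answer_set_def program_minimal_model_def reduct_edge_disjunctions
      program_model_edge_disjunctions minimal_transversal_def)

lemma program_atoms_edge_normal_program: "program_atoms (edge_normal_program E) = \<Union>E"
  by (auto simp: program_atoms_def edge_normal_program_def)

lemma normal_t_program_edge_normal_program:
  assumes "finite E" "\<And>A. A \<in> E \<Longrightarrow> finite A \<and> card A \<le> t"
  shows "normal_t_program t (edge_normal_program E)"
proof -
  have "Suc (card (A - {a})) \<le> t" if "A \<in> E" "a \<in> A" for A a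
    using that assms(2)[OF that(1)] by (metis card_Suc_Diff1)
  then show ?thesis
    using assms by (auto simp: normal_t_program_def edge_normal_program_def rule_size_def)
qed

lemma program_model_reduct:
  "program_model (reduct P M) N \<longleftrightarrow>
     (\<forall>r\<in>P. neg_body r \<inter> M = {} \<and> pos_body r \<subseteq> N \<longrightarrow> rule_head r \<inter> N \<noteq> {})"
proof -
  have "reduct P M =
      (\<lambda>r. Rule (rule_head r) (pos_body r) {}) ` {r \<in> P. neg_body r \<inter> M = {}}"
    by (auto simp: reduct_def)
  then show ?thesis by (simp add: program_model_def) blast
qed

lemma program_model_reduct_edge_normal_program:
  "program_model (reduct (edge_normal_program E) M) N \<longleftrightarrow>
     (\<forall>A\<in>E. \<forall>a\<in>A. (A - {a}) \<inter> M = {} \<longrightarrow> a \<in> N)"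
  by (simp add: program_model_reduct edge_normal_program_def)

text \<open>All positive bodies are empty, so the reduct consists of facts. A surviving rule has its
  head in \<open>M\<close>, since \<open>M\<close> must hit the edge somewhere. Conversely, the
  private edge of \<open>a\<close> leaves the fact \<open>a\<close> in the reduct, so every model of
  the reduct contains \<open>M\<close>.\<close>

lemma stable_model_edge_normal_program:
  assumes "minimal_transversal E M"
  shows "stable_model (edge_normal_program E) M"
  unfolding stable_model_def program_model_reduct_edge_normal_program
proof (intro conjI ballI allI impI subsetI)
  fix A a assume "A \<in> E" "a \<in> A" "(A - {a}) \<inter> M = {}"
  moreover have "A \<inter> M \<noteq> {}" using assms \<open>A \<in> E\<close> by (simp add: minimal_transversal_def)
  ultimately show "a \<in> M" by blast
next
  fix N a assume N: "\<forall>A\<in>E. \<forall>a\<in>A. (A - {a}) \<inter> M = {} \<longrightarrow> a \<in> N" and "a \<in> M"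
  then obtain A where "A \<in> E" "A \<inter> M = {a}"
    using assms by (auto simp: minimal_transversal_def)
  then show "a \<in> N" using N by blast
qed

section \<open>Models contain only atoms that occur\<close>

text \<open>Discarding the atoms that do not occur keeps every clause true, so minimality forbids
  such atoms. This and its analogues below make the families of models finite, without which
  \<open>card\<close> and the sum would be 0.\<close>

lemma cnf_minimal_model_subset_atoms:
  assumes "cnf_minimal_model T M"
  shows "M \<subseteq> cnf_atoms T"
proof -
  have "lit_true (M \<inter> cnf_atoms T) l" if "C \<in> T" "l \<in> C" "lit_true M l" for C l
    using that by (cases l) (force simp: cnf_atoms_def)+
  then have "cnf_model T (M \<inter> cnf_atoms T)"
    using assms by (fastforce simp: cnf_minimal_model_def cnf_model_def)
  then show ?thesis
    using assms unfolding cnf_minimal_model_def by blast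
qed

text \<open>Heads of rules consist of occurring atoms, so the restriction still hits them; bodies
  only become harder to satisfy.\<close>

lemma program_model_reduct_restrict_atoms:
  assumes "program_model (reduct P M) N"
  shows "program_model (reduct P M) (N \<inter> program_atoms P)"
  unfolding program_model_reduct
proof (intro ballI impI)
  fix r assume r: "r \<in> P" "neg_body r \<inter> M = {} \<and> pos_body r \<subseteq> N \<inter> program_atoms P"
  then have "rule_head r \<inter> N \<noteq> {}" using assms by (auto simp: program_model_reduct)
  moreover have "rule_head r \<subseteq> program_atoms P" using r(1) by (auto simp: program_atoms_def)
  ultimately show "rule_head r \<inter> (N \<inter> program_atoms P) \<noteq> {}" by blast
qed

lemma stable_model_subset_atoms:
  assumes "stable_model P M"
  shows "M \<subseteq> program_atoms P"
proof -
  have "program_model (reduct P M) (M \<inter> program_atoms P)"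
    using assms by (intro program_model_reduct_restrict_atoms) (simp add: stable_model_def)
  then have "M \<subseteq> M \<inter> program_atoms P" using assms unfolding stable_model_def by blast
  then show ?thesis by simp
qed

lemma answer_set_subset_atoms:
  assumes "answer_set P M"
  shows "M \<subseteq> program_atoms P"
proof -
  have "program_model (reduct P M) (M \<inter> program_atoms P)"
    using assms by (intro program_model_reduct_restrict_atoms)
      (simp add: answer_set_def program_minimal_model_def)
  then have "\<not> M \<inter> program_atoms P \<subset> M"
    using assms by (auto simp: answer_set_def program_minimal_model_def)
  then show ?thesis by blast
qed

section \<open>Size and counting\<close>

lemma cnf_size_le:
  assumes "t_cnf t T"
  shows "cnf_size T \<le> card T * t"
  using assms sum_bounded_above[of T card t] by (simp add: t_cnf_def cnf_size_def)

lemma program_size_le: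
  assumes "\<And>r. r \<in> P \<Longrightarrow> rule_size r \<le> t"
  shows "program_size P \<le> card P * t"
  using assms sum_bounded_above[of P rule_size t] by (simp add: program_size_def)

lemma card_edge_normal_program_le:
  assumes "finite E" "\<And>A. A \<in> E \<Longrightarrow> finite A \<and> card A \<le> t"
  shows "card (edge_normal_program E) \<le> card E * t"
proof -
  have "card (edge_normal_program E) \<le> card (SIGMA A:E. A)"
    unfolding edge_normal_program_def using assms by (intro card_image_le) auto
  also have "\<dots> = (\<Sum>A\<in>E. card A)"
    using assms by (intro card_SigmaI) auto
  also have "\<dots> \<le> card E * t"
    using assms sum_bounded_above[of E card t] by simp
  finally show ?thesis .
qed

text \<open>Transfers bounds from the explicit family \<open>F\<close> to the family
  \<open>X\<close> of all models of the kind in question; \<open>V\<close> is the set of atoms and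
  serves to make \<open>X\<close> finite.\<close>

lemma count_and_sum_ge:
  fixes X F :: "'a set set" and c w :: real
  assumes "F \<subseteq> X" "\<And>M. M \<in> X \<Longrightarrow> M \<subseteq> V" "finite V"
    and "c \<le> real (card F)" "\<And>M. M \<in> F \<Longrightarrow> w \<le> real (card M)" "0 \<le> w"
  shows "c \<le> real (card X)" "w * c \<le> real (\<Sum>M\<in>X. card M)"
proof -
  have X: "finite X" using assms(2,3) by (intro finite_subset[of X "Pow V"]) auto
  show "c \<le> real (card X)" using assms(4) card_mono[OF X assms(1)] by linarith
  have "w * c \<le> w * real (card F)" using assms by (simp add: mult_left_mono)
  also have "\<dots> \<le> (\<Sum>M\<in>F. real (card M))"
    using assms(5) sum_bounded_below[of F w "\<lambda>M. real (card M)"] by (simp add: mult.commute)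
  also have "\<dots> \<le> (\<Sum>M\<in>X. real (card M))"
    using X assms(1) by (intro sum_mono2) auto
  finally show "w * c \<le> real (\<Sum>M\<in>X. card M)" by simp
qed

section \<open>The block hypergraph\<close>

text \<open>The block size \<open>2 * t - 1\<close> is balanced: two \<open>t\<close>-subsets of a
  block must meet, while the complement of a \<open>t\<close>-subset lacks just one element to be an
  edge. Hence \<open>t\<close>-subsets of a block hit all its edges, and do so minimally.\<close>

lemma block_hypergraph_exists:
  fixes t k s n :: nat
  assumes t: "t \<ge> 1" and s: "s = 2 * t - 1" and n: "k * s \<le> n"
  shows "\<exists>E F :: nat set set. finite E \<and> (\<forall>A\<in>E. finite A \<and> A \<noteq> {} \<and> card A \<le> t) \<and>
    \<Union>E = {..<n} \<and> card E \<le> (s choose t) * n \<and>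
    (\<forall>M\<in>F. minimal_transversal E M \<and> k * t \<le> card M) \<and> card F = (s choose t) ^ k"
proof -
  define B where "B i = {i * s..<i * s + s}" for i
  have s0: "s > 0" and ts: "t \<le> s" using t s by auto
  \<comment> \<open>Describing a block by \<open>x div s\<close> makes disjointness of distinct
    blocks immediate.\<close>
  have B_iff: "x \<in> B i \<longleftrightarrow> x div s = i" for x i
  proof -
    have "x div s = i" if "i * s \<le> x" "x < i * s + s"
      using that by (intro div_nat_eqI) (simp_all add: mult.commute)
    moreover have "x div s * s \<le> x" "x < x div s * s + s"
      using dividend_less_div_times[OF s0, of x] by (simp_all add: add.commute)
    ultimately show ?thesis by (auto simp: B_def)
  qed
  have finB: "finite (B i)" and cardB: "card (B i) = s" for i by (auto simp: B_def)
  define S where "S i = {A. A \<subseteq> B i \<and> card A = t}" for i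
  have cardS: "card (S i) = s choose t" for i
    using n_subsets[OF finB, of i t] by (simp add: S_def cardB)
  have finS: "finite (S i)" for i using finB by (simp add: S_def)
  define R where "R = {k * s..<n}"
  \<comment> \<open>The singleton edges make the leftover atoms occur, so that there are exactly
    \<open>n\<close> atoms, and force them into every transversal.\<close>
  define E where "E = (\<Union>i<k. S i) \<union> (\<lambda>x. {x}) ` R"
  define U where "U f = (\<Union>i<k. f i) \<union> R" for f :: "nat \<Rightarrow> nat set"
  \<comment> \<open>Extensional functions are determined by their values below \<open>k\<close>, so
    each selection of \<open>t\<close>-subsets is counted once.\<close>
  define F where "F = U ` (Pi\<^sub>E {..<k} S)"

  have fin: "finite E" using finS by (auto simp: E_def R_def)
  have edges: "finite A \<and> A \<noteq> {} \<and> card A \<le> t" if "A \<in> E" for A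
    using that t finB by (auto simp: E_def S_def intro: finite_subset)
  have B_R: "B i \<inter> R = {}" if "i < k" for i
    using that s0 by (auto simp: R_def B_iff div_less_iff_less_mult)
  have R_n: "R \<subseteq> {..<n}" by (auto simp: R_def)
  have B_n: "B i \<subseteq> {..<n}" if "i < k" for i
  proof -
    have "i * s + s \<le> k * s" using mult_le_mono1[of "Suc i" k s] that by simp
    then show ?thesis using n by (auto simp: B_def)
  qed
  have union: "\<Union>E = {..<n}"
  proof
    show "\<Union>E \<subseteq> {..<n}" using R_n B_n by (fastforce simp: E_def S_def)
    show "{..<n} \<subseteq> \<Union>E"
    proof
      fix x assume x: "x \<in> {..<n}"
      show "x \<in> \<Union>E"
      proof (cases "x < k * s")
        case True
        then have i: "x div s < k" using s0 by (simp add: div_less_iff_less_mult)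
        have "\<exists>A. {x} \<subseteq> A \<and> A \<subseteq> B (x div s) \<and> card A = t"
          using t ts finB cardB by (intro exists_subset_between) (auto simp: B_iff)
        then show ?thesis using i by (auto simp: E_def S_def)
      next
        case False
        then show ?thesis using x by (auto simp: E_def R_def)
      qed
    qed
  qed
  have cardE: "card E \<le> (s choose t) * n"
  proof -
    have "card E \<le> card (\<Union>i<k. S i) + card ((\<lambda>x. {x}) ` R)"
      unfolding E_def by (rule card_Un_le)
    also have "\<dots> \<le> k * (s choose t) + (n - k * s)"
      using card_UN_le[of "{..<k}" S] card_image_le[of R "\<lambda>x. {x}"] by (simp add: cardS R_def)
    \<comment> \<open>The binomial coefficient is at least 1 because
      \<open>t \<le> s\<close>.\<close>
    also have "\<dots> \<le> (s choose t) * k + (s choose t) * (n - k * s)"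
      using ts by (simp add: Suc_leI)
    also have "\<dots> \<le> (s choose t) * n"
    proof -
      have "k + (n - k * s) \<le> n" using n s0 by (cases s) auto
      then show ?thesis by (simp flip: add_mult_distrib2)
    qed
    finally show ?thesis .
  qed
  have f_sub: "f i \<subseteq> B i" and f_card: "card (f i) = t" if "f \<in> Pi\<^sub>E {..<k} S" "i < k" for f i
    using PiE_mem[OF that(1), of i] that(2) by (auto simp: S_def)
  \<comment> \<open>The selection can be read off from its union; this gives injectivity of
    \<open>U\<close> and, later, the private edges.\<close>
  have U_B: "U f \<inter> B i = f i" if f: "f \<in> Pi\<^sub>E {..<k} S" and i: "i < k" for f i
  proof
    show "U f \<inter> B i \<subseteq> f i"
    proof
      fix x assume x: "x \<in> U f \<inter> B i"
      then obtain j where j: "j < k" "x \<in> f j" using B_R[OF i] by (auto simp: U_def)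
      then have "j = i" using f_sub[OF f j(1)] x by (auto simp: B_iff)
      then show "x \<in> f i" using j by simp
    qed
    show "f i \<subseteq> U f \<inter> B i" using f_sub[OF f i] i by (auto simp: U_def)
  qed
  have "inj_on U (Pi\<^sub>E {..<k} S)"
  proof
    fix f g assume fg: "f \<in> Pi\<^sub>E {..<k} S" "g \<in> Pi\<^sub>E {..<k} S" "U f = U g"
    show "f = g"
      using U_B[OF fg(1)] U_B[OF fg(2)] fg(3) by (intro PiE_ext[OF fg(1,2)]) auto
  qed
  then have cardF: "card F = (s choose t) ^ k"
    by (simp add: F_def card_image card_PiE cardS)
  have trans: "minimal_transversal E (U f)" if f: "f \<in> Pi\<^sub>E {..<k} S" for f
    unfolding minimal_transversal_def
  proof (intro conjI ballI)
    show "U f \<subseteq> \<Union>E" using f_sub[OF f] B_n R_n by (fastforce simp: U_def union)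
  next
    fix A assume "A \<in> E"
    then consider i where "i < k" "A \<in> S i" | x where "x \<in> R" "A = {x}"
      by (auto simp: E_def)
    then show "A \<inter> U f \<noteq> {}"
    proof cases
      case 1
      have "A \<inter> f i \<noteq> {}"
      \<comment> \<open>Two disjoint \<open>t\<close>-subsets would need \<open>2 * t > s\<close>
        elements of the block.\<close>
      proof
        assume "A \<inter> f i = {}"
        moreover have "finite A" "finite (f i)"
          using 1 f_sub[OF f 1(1)] finB by (auto simp: S_def intro: finite_subset)
        ultimately have "card (A \<union> f i) = 2 * t"
          using 1 f_card[OF f 1(1)] by (simp add: card_Un_disjoint S_def)
        moreover have "card (A \<union> f i) \<le> s"
          using 1 f_sub[OF f 1(1)] card_mono[OF finB[of i]] cardB by (simp add: S_def)
        ultimately show False using s t by linarith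
      qed
      then show ?thesis using 1 by (auto simp: U_def)
    qed (auto simp: U_def)
  next
    fix a assume "a \<in> U f"
    then consider i where "i < k" "a \<in> f i" | "a \<in> R" by (auto simp: U_def)
    then show "\<exists>A\<in>E. A \<inter> U f = {a}"
    proof cases
      case 1
      \<comment> \<open>The rest of the block has \<open>t - 1\<close> elements, so adding \<open>a\<close> gives an edge.\<close>
      let ?A = "insert a (B i - f i)"
      have sub: "f i \<subseteq> B i" using f_sub[OF f 1(1)] .
      then have "card (B i - f i) = s - t"
        using f_card[OF f 1(1)] finB cardB by (simp add: card_Diff_subset finite_subset)
      then have "card ?A = t" using 1 finB s t by simp
      then have "?A \<in> E" using 1 sub by (auto simp: E_def S_def)
      moreover have "?A \<inter> U f = {a}" using U_B[OF f 1(1)] 1 sub by blast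
      ultimately show ?thesis by blast
    next
      case 2
      then show ?thesis by (auto simp: E_def U_def)
    qed
  qed
  have large: "k * t \<le> card (U f)" if f: "f \<in> Pi\<^sub>E {..<k} S" for f
  proof -
    have fin_f: "finite (f i)" if "i < k" for i using f_sub[OF f that] finB finite_subset by blast
    have "f i \<inter> f j = {}" if "i < k" "j < k" "i \<noteq> j" for i j
      using f_sub[OF f that(1)] f_sub[OF f that(2)] that(3) by (auto simp: subset_iff B_iff)
    then have "card (\<Union>i<k. f i) = (\<Sum>i<k. card (f i))"
      using fin_f by (intro card_UN_disjoint) auto
    also have "\<dots> = k * t" using f_card[OF f] by simp
    finally have "k * t = card (\<Union>i<k. f i)" by simp
    also have "\<dots> \<le> card (U f)"
      using fin_f by (intro card_mono) (auto simp: U_def R_def)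
    finally show ?thesis .
  qed
  show ?thesis
  proof (intro exI conjI)
    show "\<forall>M\<in>F. minimal_transversal E M \<and> k * t \<le> card M"
      using trans large by (auto simp: F_def)
  qed (use fin edges union cardE cardF in auto)
qed

text \<open>With \<open>C\<close> the binomial coefficient and \<open>s = 2 * t - 1\<close>,
  \<open>mu t ^ n\<close> is \<open>C\<close> to the power \<open>n / s\<close>. Rounding this
  exponent to an integer costs at most one factor \<open>C\<close> compared with the
  \<open>C ^ (n div s)\<close> transversals constructed.\<close>

lemma mu_power_le:
  assumes "t \<ge> 1"
  shows "mu t ^ n \<le> real ((2 * t - 1) choose t) ^ Suc (n div (2 * t - 1))"
proof -
  define s where "s = 2 * t - 1"
  have s0: "s > 0" and "s choose t > 0" using assms by (auto simp: s_def)
  then have C: "real (s choose t) \<ge> 1" by linarith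
  have "n < Suc (n div s) * s" using dividend_less_div_times[OF s0, of n] by simp
  then have "real n \<le> real (Suc (n div s)) * real s" by (simp only: less_imp_le of_nat_le_iff flip: of_nat_mult)
  then have le: "real n / real s \<le> real (Suc (n div s))" using s0 by (simp add: field_simps)
  have "mu t ^ n = real (s choose t) powr (real n / real s)"
    using C by (simp add: mu_def s_def powr_powr flip: powr_realpow)
  also have "\<dots> \<le> real (s choose t) powr real (Suc (n div s))"
    using C le by (intro powr_mono) auto
  also have "\<dots> = real (s choose t) ^ Suc (n div s)"
    using C by (intro powr_realpow) linarith
  finally show ?thesis by (simp add: s_def)
qed

section \<open>Choice of the constants and verification of the three constructions\<close>

theorem theorem9p1:
  fixes t :: nat
  assumes "t \<ge> 2"
  shows "\<exists>d D D' :: real. d > 0 \<and> D > 0 \<and> D' > 0 \<and>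
    (\<forall>n::nat. n \<ge> 2 * t - 1 \<longrightarrow>
      (\<exists>T :: nat cnf_clause set.
          t_cnf t T \<and> card (cnf_atoms T) = n \<and>
          real (cnf_size T) \<le> d * real n \<and>
          real (card {M. cnf_minimal_model T M}) \<ge> D * mu t ^ n \<and>
          real (\<Sum>M | cnf_minimal_model T M. card M) \<ge> D' * real n * mu t ^ n) \<and>
      (\<exists>P :: nat program.
          normal_t_program t P \<and> card (program_atoms P) = n \<and>
          real (program_size P) \<le> d * real n \<and>
          real (card {M. stable_model P M}) \<ge> D * mu t ^ n \<and>
          real (\<Sum>M | stable_model P M. card M) \<ge> D' * real n * mu t ^ n) \<and>
      (\<exists>Q :: nat program.
          disjunctive_t_program t Q \<and> card (program_atoms Q) = n \<and>
          real (program_size Q) \<le> d * real n \<and>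
          real (card {M. answer_set Q M}) \<ge> D * mu t ^ n \<and>
          real (\<Sum>M | answer_set Q M. card M) \<ge> D' * real n * mu t ^ n))"
proof -
  define s where "s = 2 * t - 1"
  define C where "C = s choose t"
  have t: "t \<ge> 1" and s0: "s > 0" and C0: "C > 0" using assms by (auto simp: s_def C_def)
  \<comment> \<open>\<open>d\<close> allows for \<open>C * n\<close> edges, \<open>t\<close> rules
    per edge and \<open>t\<close> literals per rule. \<open>D\<close> absorbs the factor
    \<open>C\<close> lost in rounding \<open>n / s\<close> down, and \<open>D'\<close> is
    \<open>D / 4\<close> because the constructed models have at least \<open>n / 4\<close>
    atoms.\<close>
  define d D D' where "d = real (C * t * t)" and "D = 1 / real C" and "D' = 1 / (4 * real C)"
  show ?thesis
  proof (rule exI[of _ d], rule exI[of _ D], rule exI[of _ D'], intro conjI allI impI)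
    show "d > 0" "D > 0" "D' > 0" using t C0 by (auto simp: d_def D_def D'_def)
  next
    fix n :: nat assume "n \<ge> 2 * t - 1"
    then have n: "n \<ge> s" by (simp add: s_def)
    define k where "k = n div s"
    \<comment> \<open>At least one full block exists; the lower bound on \<open>n\<close> enters
      here.\<close>
    have k1: "k \<ge> 1" using n s0 by (simp add: k_def Suc_le_eq div_greater_zero_iff)
    have "k * s \<le> n" by (simp add: k_def)
    from block_hypergraph_exists[OF t s_def this, folded C_def]
    obtain E F :: "nat set set" where E: "finite E" "\<Union>E = {..<n}" "card E \<le> C * n"
      and edges_all: "\<forall>A\<in>E. finite A \<and> A \<noteq> {} \<and> card A \<le> t"
      and F_all: "\<forall>M\<in>F. minimal_transversal E M \<and> k * t \<le> card M"
      and cardF: "card F = C ^ k"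
      by (elim exE conjE) (rule that)
    have edges: "finite A \<and> A \<noteq> {} \<and> card A \<le> t"
      and edges': "finite A \<and> card A \<le> t" if "A \<in> E" for A
      using edges_all that by auto
    have F: "minimal_transversal E M" "k * t \<le> card M" if "M \<in> F" for M
      using F_all that by auto
    have count: "D * mu t ^ n \<le> real (card F)"
      using mu_power_le[OF t, of n] C0 by (simp add: D_def cardF k_def C_def s_def field_simps)
    have "n \<le> 4 * (k * t)"
    proof -
      have "n < Suc k * s"
        using dividend_less_div_times[OF s0, of n] by (simp add: k_def)
      \<comment> \<open>\<open>Suc k \<le> 2 * k\<close> since \<open>k\<close> is positive, and
        \<open>s \<le> 2 * t\<close>.\<close>
      also have "\<dots> \<le> (2 * k) * (2 * t)" using k1 by (intro mult_le_mono) (auto simp: s_def)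
      finally show ?thesis by simp
    qed
    then have large: "real n / 4 \<le> real (card M)" if "M \<in> F" for M
      using F(2)[OF that] by linarith
    have D': "D' * real n * mu t ^ n = real n / 4 * (D * mu t ^ n)" by (simp add: D_def D'_def)
    have bounds: "D * mu t ^ n \<le> real (card X)" "D' * real n * mu t ^ n \<le> real (\<Sum>M\<in>X. card M)"
      if "F \<subseteq> X" "\<And>M. M \<in> X \<Longrightarrow> M \<subseteq> {..<n}" for X
      using count_and_sum_ge[OF that finite_lessThan count large] unfolding D' by simp_all
    have size: "real m \<le> d * real n" if "m \<le> card E * t * t" for m
    proof -
      have "m \<le> C * n * t * t" using that mult_le_mono1[OF mult_le_mono1[OF E(3)], of t t] by linarith
      then have "real m \<le> real (C * n * t * t)" by (simp only: of_nat_le_iff)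
      then show ?thesis by (simp add: d_def mult_ac)
    qed
    \<comment> \<open>For the theory and the disjunctive program, which have one clause per edge,
      the second factor \<open>t\<close> is slack.\<close>
    have size1: "real m \<le> d * real n" if "m \<le> x * t" "x \<le> card E" for m x
    proof (rule size)
      have "m \<le> card E * t * 1" using that(1) mult_le_mono1[OF that(2), of t] by linarith
      also have "\<dots> \<le> card E * t * t" using t by (intro mult_le_mono2)
      finally show "m \<le> card E * t * t" .
    qed
    show "\<exists>T :: nat cnf_clause set.
          t_cnf t T \<and> card (cnf_atoms T) = n \<and>
          real (cnf_size T) \<le> d * real n \<and>
          real (card {M. cnf_minimal_model T M}) \<ge> D * mu t ^ n \<and>
          real (\<Sum>M | cnf_minimal_model T M. card M) \<ge> D' * real n * mu t ^ n"
    proof (intro exI conjI)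
      let ?T = "edge_cnf E"
      show T: "t_cnf t ?T" using E(1) edges' by (rule t_cnf_edge_cnf)
      show "card (cnf_atoms ?T) = n" by (simp add: cnf_atoms_edge_cnf E)
      show "real (cnf_size ?T) \<le> d * real n"
        by (rule size1[OF cnf_size_le[OF T]]) (simp add: edge_cnf_def card_image_le E(1))
      have sub: "F \<subseteq> {M. cnf_minimal_model ?T M}" using F(1) cnf_minimal_model_edge_cnf by blast
      have atoms: "M \<subseteq> {..<n}" if "M \<in> {M. cnf_minimal_model ?T M}" for M
        using that cnf_minimal_model_subset_atoms[of ?T M] by (simp add: cnf_atoms_edge_cnf E)
      show "real (card {M. cnf_minimal_model ?T M}) \<ge> D * mu t ^ n"
        "real (\<Sum>M | cnf_minimal_model ?T M. card M) \<ge> D' * real n * mu t ^ n"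
        using bounds[OF sub atoms] by simp_all
    qed
    show "\<exists>P :: nat program.
          normal_t_program t P \<and> card (program_atoms P) = n \<and>
          real (program_size P) \<le> d * real n \<and>
          real (card {M. stable_model P M}) \<ge> D * mu t ^ n \<and>
          real (\<Sum>M | stable_model P M. card M) \<ge> D' * real n * mu t ^ n"
    proof (intro exI conjI)
      let ?P = "edge_normal_program E"
      show P: "normal_t_program t ?P"
        using E(1) edges' by (rule normal_t_program_edge_normal_program)
      show "card (program_atoms ?P) = n" by (simp add: program_atoms_edge_normal_program E)
      have "program_size ?P \<le> card ?P * t"
        using P by (intro program_size_le) (auto simp: normal_t_program_def)
      \<comment> \<open>Here both factors are used: one for the choice of the head in an edge, one
        for the length of a rule.\<close>
      also have "\<dots> \<le> card E * t * t"
        using card_edge_normal_program_le[OF E(1) edges'] by simp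
      finally show "real (program_size ?P) \<le> d * real n" by (rule size)
      have sub: "F \<subseteq> {M. stable_model ?P M}" using F(1) stable_model_edge_normal_program by blast
      have atoms: "M \<subseteq> {..<n}" if "M \<in> {M. stable_model ?P M}" for M
        using that stable_model_subset_atoms[of ?P M]
        by (simp add: program_atoms_edge_normal_program E)
      show "real (card {M. stable_model ?P M}) \<ge> D * mu t ^ n"
        "real (\<Sum>M | stable_model ?P M. card M) \<ge> D' * real n * mu t ^ n"
        using bounds[OF sub atoms] by simp_all
    qed
    show "\<exists>Q :: nat program.
          disjunctive_t_program t Q \<and> card (program_atoms Q) = n \<and>
          real (program_size Q) \<le> d * real n \<and>
          real (card {M. answer_set Q M}) \<ge> D * mu t ^ n \<and>
          real (\<Sum>M | answer_set Q M. card M) \<ge> D' * real n * mu t ^ n"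
    proof (intro exI conjI)
      let ?Q = "edge_disjunctions E"
      show Q: "disjunctive_t_program t ?Q"
        using E(1) edges by (rule disjunctive_t_program_edge_disjunctions)
      show "card (program_atoms ?Q) = n" by (simp add: program_atoms_edge_disjunctions E)
      have "program_size ?Q \<le> card ?Q * t"
        using Q by (intro program_size_le) (auto simp: disjunctive_t_program_def)
      then show "real (program_size ?Q) \<le> d * real n"
        by (rule size1) (simp add: edge_disjunctions_def card_image_le E(1))
      have sub: "F \<subseteq> {M. answer_set ?Q M}" using F(1) answer_set_edge_disjunctions by blast
      have atoms: "M \<subseteq> {..<n}" if "M \<in> {M. answer_set ?Q M}" for M
        using that answer_set_subset_atoms[of ?Q M]
        by (simp add: program_atoms_edge_disjunctions E)
      show "real (card {M. answer_set ?Q M}) \<ge> D * mu t ^ n"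
        "real (\<Sum>M | answer_set ?Q M. card M) \<ge> D' * real n * mu t ^ n"
        using bounds[OF sub atoms] by simp_all
    qed
  qed
qed

end
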